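(* Let $d$ be a cube-free integer which is not a perfect cube, so that $\mathbb{Q}(\sqrt[3]{d})$ is a pure cubic field. Then $$i(\mathbb{Q}(\sqrt[3]{d}))=\begin{cases}2&\text{if } d \text{ is odd},\\ 1&\text{if } d\text{ is even}.\end{cases}$$
   Context: An integer $d$ is cube-free if no prime $p$ satisfies $p^3\mid d$. For a number field $\mathbb{K}$ of degree $n$ over $\mathbb{Q}$ with ring of integers $\mathbb{A}$, let $\widehat{\mathbb{A}}$ be the set of $\theta\in\mathbb{A}$ that are primitive over $\mathbb{Q}$, i.e. $\mathbb{K}=\mathbb{Q}(\theta)$. For $\theta\in\mathbb{A}$ let $F_\theta(x)\in\mathbb{Z}[x]$ be the (degree $n$) characteristic polynomial of $\theta$ over $\mathbb{Q}$ and set $i(\theta)=\gcd_{x\in\mathbb{Z}}F_\theta(x)$. Define $i(\mathbb{K})=\operatorname{lcm}_{\theta\in\widehat{\mathbb{A}}}\, i(\theta)$. *)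

theory Defs
  imports
    Complex_Main
    "HOL-Computational_Algebra.Nth_Powers"
    "HOL-Computational_Algebra.Polynomial"
    "Jordan_Normal_Form.Char_Poly"
begin

definition cube_free :: "int \<Rightarrow> bool" where
  "cube_free d \<longleftrightarrow> \<not> (\<exists>p. prime p \<and> p ^ 3 dvd d)"

text \<open>Number fields are represented as subsets of an ambient field of characteristic 0.\<close>

definition is_subfield :: "'a::field set \<Rightarrow> bool" where
  "is_subfield K \<longleftrightarrow> 0 \<in> K \<and> 1 \<in> K \<and>
     (\<forall>x\<in>K. \<forall>y\<in>K. x + y \<in> K \<and> x * y \<in> K) \<and>
     (\<forall>x\<in>K. - x \<in> K \<and> inverse x \<in> K)"

text \<open>The field generated by \<open>\<theta>\<close> over the rationals. As the ambient field has
  characteristic 0, every subfield contains the rationals.\<close>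

definition rat_adjoin :: "'a::field_char_0 \<Rightarrow> 'a set" where
  "rat_adjoin \<theta> = is_subfield hull {\<theta>}"

global_interpretation rat_vs:
  vector_space "(\<lambda>q x. of_rat q * x) :: rat \<Rightarrow> 'a::field_char_0 \<Rightarrow> 'a"
  by unfold_locales (simp_all add: algebra_simps of_rat_add of_rat_mult)

definition is_rat_basis :: "'a::field_char_0 set \<Rightarrow> 'a list \<Rightarrow> bool" where
  "is_rat_basis K bs \<longleftrightarrow> distinct bs \<and> rat_vs.independent (set bs) \<and> rat_vs.span (set bs) = K"

definition mult_mat :: "'a::field_char_0 list \<Rightarrow> 'a \<Rightarrow> rat mat" where
  "mult_mat bs \<theta> = mat (length bs) (length bs)
     (\<lambda>(i, j). rat_vs.representation (set bs) (\<theta> * bs ! j) (bs ! i))"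

text \<open>The characteristic polynomial of \<open>\<theta> \<in> K\<close> over the rationals is that of the linear map
  \<open>x \<mapsto> \<theta> * x\<close> on \<open>K\<close>; its degree is the degree of \<open>K\<close>. It does not depend on the basis,
  which is why an arbitrary one may be chosen.\<close>

definition field_char_poly :: "'a::field_char_0 set \<Rightarrow> 'a \<Rightarrow> rat poly" where
  "field_char_poly K \<theta> = char_poly (mult_mat (SOME bs. is_rat_basis K bs) \<theta>)"

text \<open>For an algebraic integer \<open>\<theta>\<close> the characteristic polynomial has integer coefficients;
  this is its version over the integers.\<close>

definition int_char_poly :: "'a::field_char_0 set \<Rightarrow> 'a \<Rightarrow> int poly" where
  "int_char_poly K \<theta> = (THE p. map_poly of_int p = field_char_poly K \<theta>)"

definition ring_of_integers :: "'a::field_char_0 set \<Rightarrow> 'a set" where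
  "ring_of_integers K = {\<theta> \<in> K. algebraic_int \<theta>}"

definition primitive_integers :: "'a::field_char_0 set \<Rightarrow> 'a set" where
  "primitive_integers K = {\<theta> \<in> ring_of_integers K. rat_adjoin \<theta> = K}"

definition elem_index :: "'a::field_char_0 set \<Rightarrow> 'a \<Rightarrow> int" where
  "elem_index K \<theta> = Gcd (range (poly (int_char_poly K \<theta>)))"

text \<open>For a number field \<open>K\<close> of degree \<open>n\<close>, every \<open>elem_index K \<theta>\<close> divides \<open>n!\<close>
  (the \<open>n\<close>-th difference of a monic integer polynomial of degree \<open>n\<close>),
  so the \<open>Lcm\<close> is over a finite set of nonzero integers.\<close>

definition field_index :: "'a::field_char_0 set \<Rightarrow> int" where
  "field_index K = Lcm (elem_index K ` primitive_integers K)"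

end

theory Submission
  imports Defs
begin

text \<open>
  Write \<open>\<alpha> = root 3 d\<close> and \<open>\<theta> = a + b \<alpha> + c \<alpha>\<^sup>2\<close> with rational \<open>a, b, c\<close>, and let
  \<open>x\<^sup>3 - t x\<^sup>2 + s x - n\<close> be the characteristic polynomial of an integral \<open>\<theta>\<close>.
  Its index divides \<open>3! = 6\<close>. If \<open>3\<close> divided it, then \<open>t \<equiv> n \<equiv> 0\<close> and \<open>s \<equiv> -1\<close> modulo 3, so
  \<open>a = t / 3\<close> is an integer, and after a shift \<open>a = 0\<close>. The numbers \<open>u = d b\<^sup>3\<close> and \<open>v = d\<^sup>2 c\<^sup>3\<close>
  then satisfy \<open>u + v = n\<close> and \<open>27 u v = - s\<^sup>3\<close>, so \<open>27 (u - v)\<^sup>2 = 27 n\<^sup>2 + 4 s\<^sup>3\<close> is an integer prime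
  to 3, whereas 3 occurs in it to an odd power.

  If \<open>d\<close> is even, pass to \<open>3 \<theta>\<close>, so that all of \<open>t\<close>, \<open>u\<close>, \<open>v\<close> are integers. Since the exponent of 2 in
  \<open>d\<close> is 1 or 2, those in \<open>u\<close> and \<open>v\<close> are not divisible by 3, hence \<open>u\<close> and \<open>v\<close> are even. This
  forces \<open>t \<equiv> s \<equiv> n\<close> modulo 2, and the values at 0 and 1 are not both even. If \<open>d\<close> is odd,
  \<open>\<alpha> + \<alpha>\<^sup>2\<close> has an even index.
\<close>

section \<open>Independence of the basis\<close>

text \<open>Source and target bases may differ: \<open>\<theta> = 1\<close> gives change-of-basis
  matrices and \<open>bs = cs\<close> gives \<open>mult_mat\<close>, so one product rule serves
  both.\<close>

definition basis_mat :: "'a::field_char_0 list \<Rightarrow> 'a list \<Rightarrow> 'a \<Rightarrow> rat mat" where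
  "basis_mat bs cs \<theta> = mat (length bs) (length cs)
     (\<lambda>(i, j). rat_vs.representation (set bs) (\<theta> * cs ! j) (bs ! i))"

lemma basis_mat_carrier [simp]: "basis_mat bs cs \<theta> \<in> carrier_mat (length bs) (length cs)"
  by (simp add: basis_mat_def)

lemma mult_mat_eq_basis_mat: "mult_mat bs \<theta> = basis_mat bs bs \<theta>"
  by (simp add: mult_mat_def basis_mat_def)

lemma sum_nth_distinct:
  assumes "distinct xs"
  shows "(\<Sum>k<length xs. f (xs ! k)) = sum f (set xs)"
  using sum.reindex_bij_betw[OF bij_betw_nth[OF assms refl refl], of f]
  by (simp add: atLeast0LessThan)

text \<open>Matrices of composed linear maps multiply: expand \<open>\<theta> * ds ! j\<close> in
  \<open>cs\<close>, apply \<open>\<eta>\<close> termwise and read off coordinates in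
  \<open>bs\<close>.\<close>

lemma basis_mat_mult:
  assumes bs: "is_rat_basis K bs" and cs: "is_rat_basis K cs"
    and \<eta>: "\<And>x. x \<in> K \<Longrightarrow> \<eta> * x \<in> K" and \<theta>: "\<And>x. x \<in> set ds \<Longrightarrow> \<theta> * x \<in> K"
  shows "basis_mat bs cs \<eta> * basis_mat cs ds \<theta> = basis_mat bs ds (\<eta> * \<theta>)"
proof (rule eq_matI)
  fix i j assume ij: "i < dim_row (basis_mat bs ds (\<eta> * \<theta>))" "j < dim_col (basis_mat bs ds (\<eta> * \<theta>))"
  then have i: "i < length bs" and j: "j < length ds" by (auto simp: basis_mat_def)
  let ?rb = "rat_vs.representation (set bs)" and ?rc = "rat_vs.representation (set cs)"
  define v where "v = \<theta> * ds ! j"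
  have vK: "v \<in> K" unfolding v_def using \<theta> j by auto
  from bs have b: "rat_vs.independent (set bs)" "rat_vs.span (set bs) = K" by (auto simp: is_rat_basis_def)
  from cs have c: "rat_vs.independent (set cs)" "rat_vs.span (set cs) = K" "distinct cs"
    by (auto simp: is_rat_basis_def)
  have cK: "x \<in> K" if "x \<in> set cs" for x using c that rat_vs.span_base by blast
  have "v = (\<Sum>x\<in>set cs. of_rat (?rc v x) * x)"
    by (rule rat_vs.sum_representation_eq[symmetric]) (use c vK in auto)
  then have "\<eta> * v = (\<Sum>x\<in>set cs. of_rat (?rc v x) * (\<eta> * x))"
    by (metis (no_types, lifting) mult.left_commute sum.cong sum_distrib_left)
  then have "?rb (\<eta> * v) = ?rb (\<Sum>x\<in>set cs. of_rat (?rc v x) * (\<eta> * x))" by simp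
  also have "\<dots> = (\<lambda>y. \<Sum>x\<in>set cs. ?rb (of_rat (?rc v x) * (\<eta> * x)) y)"
  proof (rule rat_vs.representation_sum)
    fix x assume "x \<in> set cs"
    then have "\<eta> * x \<in> rat_vs.span (set bs)" using b \<eta> cK by auto
    then show "of_rat (?rc v x) * (\<eta> * x) \<in> rat_vs.span (set bs)" by (rule rat_vs.span_scale)
  qed (use b in auto)
  also have "\<dots> = (\<lambda>y. \<Sum>x\<in>set cs. ?rc v x * ?rb (\<eta> * x) y)"
  proof (intro ext sum.cong refl)
    fix x y assume "x \<in> set cs"
    then have "\<eta> * x \<in> rat_vs.span (set bs)" using b \<eta> cK by auto
    then show "?rb (of_rat (?rc v x) * (\<eta> * x)) y = ?rc v x * ?rb (\<eta> * x) y"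
      by (simp add: rat_vs.representation_scale[OF b(1)])
  qed
  finally have "?rb (\<eta> * v) (bs ! i) = (\<Sum>x\<in>set cs. ?rb (\<eta> * x) (bs ! i) * ?rc v x)"
    by (simp add: mult.commute)
  also have "\<dots> = (\<Sum>k<length cs. ?rb (\<eta> * cs ! k) (bs ! i) * ?rc v (cs ! k))"
    using sum_nth_distinct[OF c(3), of "\<lambda>x. ?rb (\<eta> * x) (bs ! i) * ?rc v x"] by simp
  finally show "(basis_mat bs cs \<eta> * basis_mat cs ds \<theta>) $$ (i, j) = basis_mat bs ds (\<eta> * \<theta>) $$ (i, j)"
    using i j by (simp add: basis_mat_def scalar_prod_def v_def mult.assoc atLeast0LessThan)
qed (auto simp: basis_mat_def)

lemma basis_mat_one:
  assumes "is_rat_basis K bs"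
  shows "basis_mat bs bs 1 = 1\<^sub>m (length bs)"
proof (rule eq_matI)
  fix i j assume "i < dim_row (1\<^sub>m (length bs) :: rat mat)" "j < dim_col (1\<^sub>m (length bs) :: rat mat)"
  then show "basis_mat bs bs 1 $$ (i, j) = 1\<^sub>m (length bs) $$ (i, j)"
    using assms by (auto simp: basis_mat_def is_rat_basis_def rat_vs.representation_basis nth_eq_iff_index_eq)
qed (auto simp: basis_mat_def)

lemma is_rat_basis_length:
  assumes "is_rat_basis K bs" "is_rat_basis K cs"
  shows "length bs = length cs"
proof -
  have "card (set bs) = rat_vs.dim K" "card (set cs) = rat_vs.dim K"
    using assms by (metis is_rat_basis_def rat_vs.dim_span_eq_card_independent)+
  then show ?thesis using assms by (simp add: is_rat_basis_def distinct_card)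
qed

text \<open>The two change-of-basis matrices are mutually inverse and conjugate one multiplication
  matrix into the other. This makes the arbitrary choice in \<open>field_char_poly\<close>
  harmless.\<close>

lemma char_poly_mult_mat_basis:
  assumes bs: "is_rat_basis K bs" and cs: "is_rat_basis K cs" and \<theta>: "\<And>x. x \<in> K \<Longrightarrow> \<theta> * x \<in> K"
  shows "char_poly (mult_mat bs \<theta>) = char_poly (mult_mat cs \<theta>)"
proof (rule char_poly_similar)
  have sub: "set bs \<subseteq> K" "set cs \<subseteq> K"
    using bs cs rat_vs.span_superset unfolding is_rat_basis_def by blast+
  let ?P = "basis_mat bs cs 1" and ?Q = "basis_mat cs bs 1" and ?n = "length cs"
  note len = is_rat_basis_length[OF bs cs]
  have PQ: "?P * ?Q = 1\<^sub>m ?n" "?Q * ?P = 1\<^sub>m ?n"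
    using basis_mat_mult[OF bs cs, of 1 bs 1] basis_mat_mult[OF cs bs, of 1 cs 1] sub len
      basis_mat_one[OF bs] basis_mat_one[OF cs] by auto
  have "?P * basis_mat cs cs \<theta> = basis_mat bs cs \<theta>"
    using basis_mat_mult[OF bs cs, of 1 cs \<theta>] sub \<theta> by auto
  moreover have "basis_mat bs cs \<theta> * ?Q = basis_mat bs bs \<theta>"
    using basis_mat_mult[OF bs cs, of \<theta> bs 1] sub \<theta> by auto
  ultimately show "similar_mat (mult_mat bs \<theta>) (mult_mat cs \<theta>)"
    unfolding mult_mat_eq_basis_mat
    using basis_mat_carrier[of bs bs \<theta>] basis_mat_carrier[of cs cs \<theta>]
      basis_mat_carrier[of bs cs 1] basis_mat_carrier[of cs bs 1] len PQ
    by (intro similar_matI[where n = ?n and P = ?P and Q = ?Q]) auto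
qed

lemma field_char_poly_eq:
  assumes "is_rat_basis K bs" and "\<And>x. x \<in> K \<Longrightarrow> \<theta> * x \<in> K"
  shows "field_char_poly K \<theta> = char_poly (mult_mat bs \<theta>)"
  unfolding field_char_poly_def
  by (rule char_poly_mult_mat_basis[where K = K]) (rule someI[of "is_rat_basis K", OF assms(1)], fact+)

lemma det_3:
  fixes f :: "nat \<times> nat \<Rightarrow> 'a::comm_ring_1"
  shows "det (mat 3 3 f) =
     f (0,0) * (f (1,1) * f (2,2) - f (1,2) * f (2,1))
   - f (0,1) * (f (1,0) * f (2,2) - f (1,2) * f (2,0))
   + f (0,2) * (f (1,0) * f (2,1) - f (1,1) * f (2,0))"
proof -
  have two: "det (mat 2 2 g) = g (0,0) * g (1,1) - g (0,1) * g (1,0)" for g :: "nat \<times> nat \<Rightarrow> 'a"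
    by (subst laplace_expansion_row[of _ 2 0])
       (auto simp: cofactor_def mat_delete_def numeral_2_eq_2 det_single)
  have sub: "mat_delete (mat 3 3 f) 0 j = mat 2 2 (\<lambda>(i, k). f (Suc i, if k < j then k else Suc k))" for j
    by (auto simp: mat_delete_def)
  have "{..<3} = {0, 1, 2::nat}" by auto
  then have "det (mat 3 3 f) = (\<Sum>j\<in>{0,1,2}. f (0,j) * ((-1)^j * det (mat_delete (mat 3 3 f) 0 j)))"
    by (subst laplace_expansion_row[of _ 3 0]) (auto simp: cofactor_def)
  then show ?thesis unfolding sub two by (simp add: numeral_2_eq_2 algebra_simps)
qed

section \<open>Integrality\<close>

lemma rat_root_of_int:
  assumes "x ^ n = (of_int k :: rat)" and "n > 0"
  shows "x \<in> \<int>"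
proof (rule rational_algebraic_int_is_int)
  show "algebraic_int x"
    by (rule algebraic_int_root[where p = "monom 1 n" and y = "of_int k"])
       (use assms in \<open>auto simp: poly_monom degree_monom_eq intro: int_imp_algebraic_int\<close>)
qed (simp add: Rats_def)

text \<open>Serves to show that two rationals with integral sum and product are integers.\<close>

lemma rat_quadratic_root_of_int:
  assumes "x\<^sup>2 - of_int m * x + of_int k = (0 :: rat)"
  shows "x \<in> \<int>"
proof (rule rational_algebraic_int_is_int)
  show "algebraic_int x"
    unfolding algebraic_int_altdef_ipoly
    using assms by (intro exI[of _ "[:k, - m, 1:]"])
      (simp add: of_int_hom.map_poly_pCons_hom algebra_simps power2_eq_square)
qed (simp add: Rats_def)

abbreviation rat_poly :: "int poly \<Rightarrow> rat poly" where
  "rat_poly \<equiv> map_poly of_int"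

text \<open>Clear denominators, then divide by the content.\<close>

lemma primitive_int_multiple:
  fixes f :: "rat poly"
  assumes "lead_coeff f = 1"
  shows "\<exists>m f'. m \<noteq> 0 \<and> content f' = 1 \<and> rat_poly f' = Polynomial.smult (of_int m) f"
proof -
  have "\<exists>k p. k \<noteq> 0 \<and> rat_poly p = Polynomial.smult (of_int k) f"
  proof (induction f)
    case 0
    show ?case by (intro exI[of _ 1] exI[of _ 0]) simp
  next
    case (pCons a f)
    then obtain k p where kp: "k \<noteq> 0" "rat_poly p = Polynomial.smult (of_int k) f" by blast
    obtain x y where a: "a = of_int x / of_int y" "y > 0"
      using quotient_of_div[of a] quotient_of_denom_pos[of a] by (cases "quotient_of a") auto
    have "rat_poly (pCons (k * x) (Polynomial.smult y p)) = Polynomial.smult (of_int (k * y)) (pCons a f)"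
      using a kp(2) by (simp add: of_int_hom.map_poly_pCons_hom of_int_hom.map_poly_hom_smult mult.commute)
    then show ?case using kp(1) a(2) by (intro exI[of _ "k * y"] exI conjI) auto
  qed
  then obtain k p where k: "k \<noteq> 0" and p: "rat_poly p = Polynomial.smult (of_int k) f" by blast
  define q where "q = primitive_part p"
  have "p \<noteq> 0" using assms k p by auto
  then have c: "content q = 1" "content p \<noteq> 0" by (simp_all add: q_def)
  have "p = Polynomial.smult (content p) q" by (simp add: q_def)
  then have eq: "Polynomial.smult (of_int k) f = Polynomial.smult (of_int (content p)) (rat_poly q)"
    unfolding p[symmetric] by (metis of_int_hom.map_poly_hom_smult)
  \<comment> \<open>As \<open>f\<close> is monic, comparing leading coefficients identifies the
    remaining multiplier as \<open>lead_coeff q\<close>, an integer.\<close>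
  have "of_int k = (of_int (content p) * of_int (lead_coeff q) :: rat)"
    using arg_cong[OF eq, of lead_coeff] assms unfolding lead_coeff_smult by simp
  with eq have "Polynomial.smult (of_int (content p)) (rat_poly q)
      = Polynomial.smult (of_int (content p)) (Polynomial.smult (of_int (lead_coeff q)) f)"
    by (simp only: smult_smult)
  then have "rat_poly q = Polynomial.smult (of_int (lead_coeff q)) f"
    using c(2) smult_cancel by (metis of_int_eq_0_iff)
  then show ?thesis using c(1) by (intro exI[of _ "lead_coeff q"] exI[of _ q]) auto
qed

text \<open>Gauss's lemma: scale both factors to primitive integer polynomials. Contents are
  multiplicative and the monic \<open>h\<close> has content 1, so both scaling factors are
  units.\<close>

lemma gauss_monic_factor:
  fixes f g :: "rat poly"
  assumes fg: "f * g = rat_poly h" and f: "lead_coeff f = 1" and h: "lead_coeff h = 1"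
  shows "\<exists>p. f = rat_poly p"
proof -
  have "lead_coeff (f * g) = 1" unfolding fg using h by simp
  then have g: "lead_coeff g = 1" using f by (simp add: lead_coeff_mult)
  obtain m f' where f': "m \<noteq> 0" "content f' = 1" "rat_poly f' = Polynomial.smult (of_int m) f"
    using primitive_int_multiple[OF f] by blast
  obtain l g' where g': "l \<noteq> 0" "content g' = 1" "rat_poly g' = Polynomial.smult (of_int l) g"
    using primitive_int_multiple[OF g] by blast
  have "rat_poly (f' * g') = Polynomial.smult (of_int m) f * Polynomial.smult (of_int l) g"
    by (simp only: of_int_poly_hom.hom_mult f'(3) g'(3))
  also have "\<dots> = Polynomial.smult (of_int (m * l)) (rat_poly h)"
    by (simp only: mult_smult_left mult_smult_right smult_smult fg of_int_mult mult.commute[of "of_int l"])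
  also have "\<dots> = rat_poly (Polynomial.smult (m * l) h)"
    by (simp only: of_int_hom.map_poly_hom_smult)
  finally have "rat_poly (f' * g') = rat_poly (Polynomial.smult (m * l) h)" .
  then have "f' * g' = Polynomial.smult (m * l) h" by simp
  moreover have "content (f' * g') = 1" by (simp add: content_mult f' g')
  moreover have "content h = 1"
    by (metis content_dvd_coeff h is_unit_normalize normalize_content)
  ultimately have "\<bar>m * l\<bar> = 1" by simp
  then have "\<bar>m\<bar> = 1" by (rule abs_zmult_eq_1)
  then have "m * m = 1" by (auto simp: abs_if split: if_splits)
  then have "of_int m * of_int m = (1 :: rat)" by (simp flip: of_int_mult)
  \<comment> \<open>Since \<open>m * m = 1\<close>, multiplying \<open>rat_poly f' = m f\<close> by
    \<open>m\<close> recovers \<open>f\<close>.\<close>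
  then have "f = rat_poly (Polynomial.smult m f')"
    by (simp only: of_int_hom.map_poly_hom_smult f'(3) smult_smult smult_1_left)
  then show ?thesis by blast
qed

section \<open>Pure cubic fields\<close>

lemma is_subfield_rat_adjoin: "is_subfield (rat_adjoin \<theta>)"
  unfolding rat_adjoin_def hull_def is_subfield_def by blast

lemma generator_in_rat_adjoin: "\<theta> \<in> rat_adjoin \<theta>"
  unfolding rat_adjoin_def by (rule hull_inc) simp

lemma rat_adjoin_minimal: "is_subfield K \<Longrightarrow> \<theta> \<in> K \<Longrightarrow> rat_adjoin \<theta> \<subseteq> K"
  unfolding rat_adjoin_def by (rule hull_minimal) simp

lemma is_subfield_of_int:
  assumes "is_subfield K"
  shows "of_int k \<in> K"
proof -
  have "of_nat n \<in> K" for n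
    by (induction n) (use assms in \<open>auto simp: is_subfield_def\<close>)
  then show ?thesis
    by (cases k rule: int_cases2) (use assms in \<open>auto simp: is_subfield_def\<close>)
qed

lemma is_subfield_of_rat:
  assumes "is_subfield K"
  shows "of_rat q \<in> K"
proof (cases q)
  case (Fract a b)
  then have "of_rat q = of_int a * inverse (of_int b :: 'a)"
    by (simp add: of_rat_rat divide_inverse)
  then show ?thesis using assms is_subfield_of_int[OF assms] by (metis is_subfield_def)
qed

lemma is_subfield_Rats: "is_subfield (range of_rat :: 'a::field_char_0 set)"
  unfolding is_subfield_def
proof (intro conjI ballI)
  show "0 \<in> range (of_rat :: rat \<Rightarrow> 'a)" by (metis of_rat_0 rangeI)
  show "1 \<in> range (of_rat :: rat \<Rightarrow> 'a)" by (metis of_rat_1 rangeI)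
qed (auto simp flip: of_rat_add of_rat_mult of_rat_minus of_rat_inverse)

section \<open>Arithmetic in the coordinates \<open>1, \<alpha>, \<alpha>\<^sup>2\<close>\<close>

locale pure_cubic =
  fixes \<alpha> :: "'a::field_char_0" and d :: int
  assumes cube: "\<alpha> ^ 3 = of_int d" and not_cube: "\<not> is_nth_power 3 d"
begin

definition elem :: "rat \<Rightarrow> rat \<Rightarrow> rat \<Rightarrow> 'a" where
  "elem a b c = of_rat a + of_rat b * \<alpha> + of_rat c * \<alpha>\<^sup>2"

lemma rat_cube_neq: "x ^ 3 \<noteq> (of_int d :: rat)"
proof
  assume x: "x ^ 3 = of_int d"
  then have "x \<in> \<int>" by (rule rat_root_of_int) simp
  then obtain y where "x = of_int y" by (elim Ints_cases)
  with x have "of_int (y ^ 3) = (of_int d :: rat)" by simp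
  then have "y ^ 3 = d" by (simp only: of_int_eq_iff)
  then show False using not_cube by (auto simp: is_nth_power_def)
qed

text \<open>Otherwise \<open>b / c\<close> would be a rational cube root of \<open>d\<close>. All
  nonvanishing arguments below reduce to this.\<close>

lemma proportional_cubes:
  assumes "b ^ 3 = (of_int d :: rat) * c ^ 3"
  shows "b = 0 \<and> c = 0"
proof -
  have "c = 0"
  proof (rule ccontr)
    assume "c \<noteq> 0"
    then have "(b / c) ^ 3 = of_int d" using assms by (simp add: power_divide)
    then show False using rat_cube_neq by blast
  qed
  then show ?thesis using assms by simp
qed

lemma d_nonzero: "d \<noteq> 0"
  using not_cube by (intro notI) simp

lemma cube_of_rat: "\<alpha> ^ 3 = of_rat (of_int d)"
  by (simp add: cube)

lemma alpha_irrational: "\<alpha> \<noteq> of_rat q"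
  using cube_of_rat rat_cube_neq[of q] by (metis of_rat_eq_iff of_rat_power)

lemma elem_mult:
  "elem a b c * elem a' b' c' =
   elem (a*a' + of_int d*(b*c' + c*b')) (a*b' + b*a' + of_int d*(c*c')) (a*c' + b*b' + c*a')"
proof -
  have "elem a b c * elem a' b' c' = of_rat (a*a') + of_rat (a*b' + b*a') * \<alpha>
      + of_rat (a*c' + b*b' + c*a') * \<alpha>\<^sup>2 + of_rat (b*c' + c*b') * \<alpha>^3 + of_rat (c*c') * (\<alpha>^3 * \<alpha>)"
    unfolding elem_def of_rat_add of_rat_mult by (simp add: algebra_simps power2_eq_square power3_eq_cube)
  also have "\<dots> = elem (a*a' + of_int d*(b*c' + c*b')) (a*b' + b*a' + of_int d*(c*c')) (a*c' + b*b' + c*a')"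
    unfolding cube_of_rat elem_def of_rat_add of_rat_mult by (simp add: algebra_simps)
  finally show ?thesis .
qed

lemma elem_add: "elem a b c + elem a' b' c' = elem (a + a') (b + b') (c + c')"
  by (simp add: elem_def of_rat_add algebra_simps)

lemma elem_minus: "- elem a b c = elem (- a) (- b) (- c)"
  by (simp add: elem_def of_rat_minus)

lemma elem_diff: "elem a b c - elem a' b' c' = elem (a - a') (b - b') (c - c')"
  by (simp add: elem_def of_rat_diff algebra_simps)

lemma elem_scale: "of_rat q * elem a b c = elem (q * a) (q * b) (q * c)"
  unfolding elem_def of_rat_mult by (simp only: distrib_left mult.assoc)

lemma elem_rat: "elem q 0 0 = of_rat q"
  by (simp add: elem_def)

lemma elem_alpha: "elem 0 1 0 = \<alpha>"
  by (simp add: elem_def)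

lemma elem_linear_0:
  assumes "elem a b 0 = 0"
  shows "a = 0 \<and> b = 0"
proof -
  have "b = 0"
  proof (rule ccontr)
    assume "b \<noteq> 0"
    have "of_rat b * \<alpha> = of_rat (- a)"
      using assms by (simp add: elem_def of_rat_minus add_eq_0_iff)
    then have "\<alpha> = of_rat (- a / b)"
      using \<open>b \<noteq> 0\<close> by (metis mult.commute nonzero_eq_divide_eq of_rat_divide of_rat_eq_0_iff)
    then show False using alpha_irrational by blast
  qed
  then show ?thesis using assms by (simp add: elem_def)
qed

text \<open>A quadratic relation for \<open>\<alpha>\<close> leaves a linear remainder on division
  of \<open>x^3 - d\<close>. Its coefficients must vanish, and together they give
  \<open>b^3 = d c^3\<close>.\<close>

lemma elem_eq_0_iff: "elem a b c = 0 \<longleftrightarrow> a = 0 \<and> b = 0 \<and> c = 0"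
proof
  assume 0: "elem a b c = 0"
  have "c = 0"
  proof -
    \<comment> \<open>the remainder of \<open>c\<^sup>2 (x\<^sup>3 - d)\<close> modulo \<open>c x\<^sup>2 + b x + a\<close>\<close>
    have "elem (a*b - of_int d * c\<^sup>2) (b\<^sup>2 - a*c) 0 = elem a b c * elem b (- c) 0"
      by (simp add: elem_mult power2_eq_square algebra_simps)
    then have "elem (a*b - of_int d * c\<^sup>2) (b\<^sup>2 - a*c) 0 = 0" using 0 by simp
    then have *: "b\<^sup>2 = a*c" "a*b = of_int d * c\<^sup>2" using elem_linear_0 by fastforce+
    have "b\<^sup>2 * b = (a*b) * c" using *(1) by simp
    then have "b ^ 3 = of_int d * c ^ 3" unfolding *(2) by (simp add: power2_eq_square power3_eq_cube mult.assoc)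
    then show ?thesis using proportional_cubes by blast
  qed
  then show "a = 0 \<and> b = 0 \<and> c = 0" using elem_linear_0 0 by blast
qed (simp add: elem_def)

lemma elem_eq_iff: "elem a b c = elem a' b' c' \<longleftrightarrow> a = a' \<and> b = b' \<and> c = c'"
  using elem_eq_0_iff[of "a - a'" "b - b'" "c - c'"] by (simp flip: elem_diff)

text \<open>The product of \<open>a + b z \<alpha> + c z^2 \<alpha>^2\<close> over the three cube
  roots of unity \<open>z\<close>.\<close>

definition elem_norm :: "rat \<Rightarrow> rat \<Rightarrow> rat \<Rightarrow> rat" where
  "elem_norm a b c = a^3 + of_int d * b^3 + (of_int d)\<^sup>2 * c^3 - 3*a*b*c*of_int d"

\<comment> \<open>the second factor is the product of the two other conjugates\<close>
lemma elem_mult_conjugates: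
  "elem a b c * elem (a\<^sup>2 - b*c*of_int d) (c\<^sup>2*of_int d - a*b) (b\<^sup>2 - a*c) = elem (elem_norm a b c) 0 0"
  unfolding elem_mult elem_eq_iff elem_norm_def by (simp add: algebra_simps power2_eq_square power3_eq_cube)

text \<open>Divide the product of the other two conjugates by the norm. The norm is nonzero because
  neither factor of it vanishes.\<close>

lemma inverse_elem_exists: "\<exists>a' b' c'. inverse (elem a b c) = elem a' b' c'"
proof (cases "elem a b c = 0")
  case True
  then show ?thesis by (metis inverse_zero)
next
  case False
  define N where "N = elem_norm a b c"
  let ?e = "elem (a\<^sup>2 - b*c*of_int d) (c\<^sup>2*of_int d - a*b) (b\<^sup>2 - a*c)"
  have mult: "elem a b c * ?e = of_rat N" using elem_mult_conjugates by (simp add: N_def elem_rat)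
  have "?e \<noteq> 0"
  proof
    assume "?e = 0"
    then have a: "a\<^sup>2 = b*c*of_int d" and *: "b\<^sup>2 = a*c" "a*b = of_int d * c\<^sup>2"
      by (simp_all add: elem_eq_0_iff mult.commute)
    have "b\<^sup>2 * b = (a*b) * c" using *(1) by simp
    then have "b ^ 3 = of_int d * c ^ 3" unfolding *(2) by (simp add: power2_eq_square power3_eq_cube mult.assoc)
    then have "b = 0 \<and> c = 0" by (rule proportional_cubes)
    then show False using a False by (simp add: elem_eq_0_iff)
  qed
  with False mult have N: "N \<noteq> 0" by fastforce
  have "elem a b c * (of_rat (inverse N) * ?e) = of_rat (inverse N) * of_rat N"
    by (metis mult mult.left_commute)
  also have "\<dots> = 1" using N by (simp add: of_rat_inverse)
  finally have "inverse (elem a b c) = of_rat (inverse N) * ?e" by (rule inverse_unique)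
  then show ?thesis unfolding elem_scale by (intro exI)
qed

lemma is_subfield_elems: "is_subfield {x. \<exists>a b c. x = elem a b c}"
proof -
  have "0 = elem 0 0 0" "1 = elem 1 0 0" by (simp_all add: elem_def)
  moreover have "\<exists>a'' b'' c''. elem a b c + elem a' b' c' = elem a'' b'' c''"
      and "\<exists>a'' b'' c''. elem a b c * elem a' b' c' = elem a'' b'' c''"
      and "\<exists>a'' b'' c''. - elem a b c = elem a'' b'' c''" for a b c a' b' c'
    unfolding elem_add elem_mult elem_minus by (blast intro: refl)+
  ultimately show ?thesis
    unfolding is_subfield_def using inverse_elem_exists by auto
qed

lemma elem_in_subfield:
  assumes "is_subfield K" "\<alpha> \<in> K"
  shows "elem a b c \<in> K"
  using assms is_subfield_of_rat[OF assms(1)] unfolding elem_def is_subfield_def by (simp add: power2_eq_square)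

lemma rat_adjoin_alpha: "rat_adjoin \<alpha> = {x. \<exists>a b c. x = elem a b c}"
proof
  show "rat_adjoin \<alpha> \<subseteq> {x. \<exists>a b c. x = elem a b c}"
    using elem_alpha[symmetric] by (intro rat_adjoin_minimal is_subfield_elems) auto
  show "{x. \<exists>a b c. x = elem a b c} \<subseteq> rat_adjoin \<alpha>"
    using elem_in_subfield[OF is_subfield_rat_adjoin generator_in_rat_adjoin] by auto
qed

section \<open>The basis of powers of \<open>\<alpha>\<close> and the characteristic
  polynomial\<close>

lemma alpha_powers_distinct: "1 \<noteq> \<alpha>" "1 \<noteq> \<alpha>\<^sup>2" "\<alpha> \<noteq> \<alpha>\<^sup>2"
proof -
  have "elem 1 0 0 = 1" "elem 0 1 0 = \<alpha>" "elem 0 0 1 = \<alpha>\<^sup>2" by (simp_all add: elem_def)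
  then show "1 \<noteq> \<alpha>" "1 \<noteq> \<alpha>\<^sup>2" "\<alpha> \<noteq> \<alpha>\<^sup>2"
    using elem_eq_iff zero_neq_one by metis+
qed

lemma is_rat_basis_alpha: "is_rat_basis (rat_adjoin \<alpha>) [1, \<alpha>, \<alpha>\<^sup>2]"
  unfolding is_rat_basis_def
proof (intro conjI)
  show "distinct [1, \<alpha>, \<alpha>\<^sup>2]" using alpha_powers_distinct by simp
  show "rat_vs.independent (set [1, \<alpha>, \<alpha>\<^sup>2])"
  proof (rule rat_vs.independent_if_scalars_zero)
    fix f :: "'a \<Rightarrow> rat" and x
    assume "(\<Sum>x\<in>set [1, \<alpha>, \<alpha>\<^sup>2]. of_rat (f x) * x) = 0" and x: "x \<in> set [1, \<alpha>, \<alpha>\<^sup>2]"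
    then have "elem (f 1) (f \<alpha>) (f (\<alpha>\<^sup>2)) = 0"
      using alpha_powers_distinct by (simp add: elem_def add.assoc)
    then show "f x = 0" using x by (auto simp: elem_eq_0_iff)
  qed simp
  show "rat_vs.span (set [1, \<alpha>, \<alpha>\<^sup>2]) = rat_adjoin \<alpha>"
  proof
    show "rat_vs.span (set [1, \<alpha>, \<alpha>\<^sup>2]) \<subseteq> rat_adjoin \<alpha>"
    proof (rule rat_vs.span_minimal)
      note F = is_subfield_rat_adjoin[of \<alpha>] generator_in_rat_adjoin[of \<alpha>]
      show "set [1, \<alpha>, \<alpha>\<^sup>2] \<subseteq> rat_adjoin \<alpha>"
        using F by (simp add: is_subfield_def power2_eq_square)
      show "rat_vs.subspace (rat_adjoin \<alpha>)"
        unfolding rat_vs.subspace_def using F is_subfield_of_rat[OF F(1)] by (simp add: is_subfield_def)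
    qed
    show "rat_adjoin \<alpha> \<subseteq> rat_vs.span (set [1, \<alpha>, \<alpha>\<^sup>2])"
    proof
      fix x assume "x \<in> rat_adjoin \<alpha>"
      then obtain a b c where x: "x = of_rat a * 1 + of_rat b * \<alpha> + of_rat c * \<alpha>\<^sup>2"
        unfolding rat_adjoin_alpha elem_def by auto
      show "x \<in> rat_vs.span (set [1, \<alpha>, \<alpha>\<^sup>2])"
        unfolding x by (intro rat_vs.span_add rat_vs.span_scale rat_vs.span_base) auto
    qed
  qed
qed

lemma representation_elem:
  "rat_vs.representation {1, \<alpha>, \<alpha>\<^sup>2} (elem a b c) =
    (\<lambda>x. if x = 1 then a else if x = \<alpha> then b else if x = \<alpha>\<^sup>2 then c else 0)" (is "_ = ?f")
proof (rule rat_vs.representation_eqI)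
  show "rat_vs.independent {1, \<alpha>, \<alpha>\<^sup>2}" "elem a b c \<in> rat_vs.span {1, \<alpha>, \<alpha>\<^sup>2}"
    using is_rat_basis_alpha rat_adjoin_alpha by (auto simp: is_rat_basis_def)
  have sub: "{x. ?f x \<noteq> 0} \<subseteq> {1, \<alpha>, \<alpha>\<^sup>2}" by (auto split: if_splits)
  then show "finite {x. ?f x \<noteq> 0}" by (rule finite_subset) simp
  show "x \<in> {1, \<alpha>, \<alpha>\<^sup>2}" if "?f x \<noteq> 0" for x using that sub by blast
  have "(\<Sum>x | ?f x \<noteq> 0. of_rat (?f x) * x) = (\<Sum>x\<in>{1, \<alpha>, \<alpha>\<^sup>2}. of_rat (?f x) * x)"
    by (rule sum.mono_neutral_left) (use sub in auto)
  also have "\<dots> = elem a b c"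
    using alpha_powers_distinct by (simp add: elem_def add.assoc)
  finally show "(\<Sum>x | ?f x \<noteq> 0. of_rat (?f x) * x) = elem a b c" .
qed

lemma mult_mat_elem:
  "mult_mat [1, \<alpha>, \<alpha>\<^sup>2] (elem a b c) =
   mat 3 3 (\<lambda>(i, j). [[a, of_int d * c, of_int d * b], [b, a, of_int d * c], [c, b, a]] ! i ! j)"
proof (rule eq_matI)
  fix i j
  let ?M = "mat 3 3 (\<lambda>(i, j). [[a, of_int d * c, of_int d * b], [b, a, of_int d * c], [c, b, a]] ! i ! j)"
  assume "i < dim_row ?M" "j < dim_col ?M"
  then have "i < 3" and j: "j < 3" by auto
  then have i: "i = 0 \<or> i = 1 \<or> i = 2" and j: "j = 0 \<or> j = 1 \<or> j = 2" by linarith+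
  \<comment> \<open>The columns of the matrix, obtained from \<open>\<alpha>^3 = d\<close>.\<close>
  have m: "elem a b c * 1 = elem a b c" "elem a b c * \<alpha> = elem (of_int d * c) a b"
      "elem a b c * \<alpha>\<^sup>2 = elem (of_int d * b) (of_int d * c) a"
    using elem_mult[of a b c 0 1 0] elem_mult[of a b c 0 0 1] by (simp_all add: elem_def)
  show "mult_mat [1, \<alpha>, \<alpha>\<^sup>2] (elem a b c) $$ (i, j) = ?M $$ (i, j)"
    using i j alpha_powers_distinct alpha_powers_distinct[symmetric]
    by (elim disjE) (simp_all add: mult_mat_def m[simplified] representation_elem)
qed (auto simp: mult_mat_def)

lemma field_char_poly_elem:
  "field_char_poly (rat_adjoin \<alpha>) (elem a b c) =
    [:- elem_norm a b c, 3 * a\<^sup>2 - 3*b*c*of_int d, - 3 * a, 1:]"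
proof -
  let ?f = "\<lambda>(i, j). [[a, of_int d * c, of_int d * b], [b, a, of_int d * c], [c, b, a]] ! i ! j"
  have "field_char_poly (rat_adjoin \<alpha>) (elem a b c) = char_poly (mat 3 3 ?f)"
    unfolding mult_mat_elem[symmetric]
  proof (rule field_char_poly_eq[OF is_rat_basis_alpha])
    fix x assume "x \<in> rat_adjoin \<alpha>"
    moreover have "elem a b c \<in> rat_adjoin \<alpha>" unfolding rat_adjoin_alpha by blast
    ultimately show "elem a b c * x \<in> rat_adjoin \<alpha>"
      using is_subfield_rat_adjoin unfolding is_subfield_def by blast
  qed
  \<comment> \<open>Every entry becomes an explicit polynomial, the form in which
    \<open>det_3\<close> applies.\<close>
  also have "char_poly_matrix (mat 3 3 ?f) =
      mat 3 3 (\<lambda>(i, j). (if i = j then [:0, 1:] else 0) + [:- ?f (i, j):])"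
    by (rule eq_matI) (auto simp: char_poly_matrix_def)
  then have "char_poly (mat 3 3 ?f) = [:- elem_norm a b c, 3 * a\<^sup>2 - 3*b*c*of_int d, - 3 * a, 1:]"
    by (simp add: char_poly_def det_3 elem_norm_def algebra_simps power2_eq_square power3_eq_cube)
  finally show ?thesis .
qed

lemma primitive_irrational:
  assumes "rat_adjoin (elem a b c) = rat_adjoin \<alpha>"
  shows "b \<noteq> 0 \<or> c \<noteq> 0"
proof (rule ccontr)
  assume "\<not> (b \<noteq> 0 \<or> c \<noteq> 0)"
  then have "elem a b c \<in> range of_rat" by (simp add: elem_rat)
  then have "\<alpha> \<in> range of_rat"
    using assms rat_adjoin_minimal[OF is_subfield_Rats] generator_in_rat_adjoin by blast
  then show False using alpha_irrational by blast
qed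

text \<open>Such an element has degree 3 over the rationals: it satisfies no nontrivial relation of
  degree at most 2.\<close>

lemma elem_quadratic_0:
  assumes "b \<noteq> 0 \<or> c \<noteq> 0"
    and "of_rat p + of_rat q * elem a b c + of_rat r * (elem a b c)\<^sup>2 = 0"
  shows "p = 0 \<and> q = 0 \<and> r = 0"
proof -
  have "elem (p + q * a + r * (a\<^sup>2 + 2*b*c*of_int d)) (q * b + r * (2*a*b + of_int d * c\<^sup>2))
      (q * c + r * (2*a*c + b\<^sup>2)) = 0"
    using assms(2) unfolding power2_eq_square elem_rat[symmetric, of p] elem_mult elem_scale elem_add
    by (simp add: algebra_simps)
  then have e: "p + q * a + r * (a\<^sup>2 + 2*b*c*of_int d) = 0" "q * b + r * (2*a*b + of_int d * c\<^sup>2) = 0"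
      "q * c + r * (2*a*c + b\<^sup>2) = 0"
    by (simp_all add: elem_eq_0_iff)
  \<comment> \<open>This combination of the \<open>\<alpha>\<close> and
    \<open>\<alpha>\<^sup>2\<close> coordinates eliminates \<open>q\<close>; the factor left beside
    \<open>r\<close> is nonzero by \<open>proportional_cubes\<close>.\<close>
  have "r * (of_int d * c^3 - b^3) = c * (q * b + r * (2*a*b + of_int d * c\<^sup>2)) - b * (q * c + r * (2*a*c + b\<^sup>2))"
    by (simp add: algebra_simps power2_eq_square power3_eq_cube)
  then have r: "r * (of_int d * c^3 - b^3) = 0" using e by simp
  have "of_int d * c^3 - b^3 \<noteq> 0" using proportional_cubes[of b c] assms(1) by auto
  then have "r = 0" using r by simp
  then show ?thesis using e assms(1) by auto
qed

end

section \<open>Congruences for the coefficients\<close>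

abbreviation cubic :: "int \<Rightarrow> int \<Rightarrow> int \<Rightarrow> int poly" where
  "cubic t s n \<equiv> [:- n, s, - t, 1:]"

text \<open>The third difference of a monic cubic is the constant \<open>3! = 6\<close>.\<close>

lemma cubic_values_dvd_6: "Gcd (range (poly (cubic t s n))) dvd 6"
proof -
  let ?f = "poly (cubic t s n)"
  have "?f 3 - 3 * ?f 2 + 3 * ?f 1 - ?f 0 = 6" by simp
  moreover have "Gcd (range ?f) dvd ?f 3 - 3 * ?f 2 + 3 * ?f 1 - ?f 0"
    by (intro dvd_diff dvd_add dvd_mult Gcd_dvd rangeI)
  ultimately show ?thesis by metis
qed

lemma three_not_dvd_cubic_values:
  fixes a b c :: rat and d t s n :: int
  assumes t: "3 * a = of_int t" and s: "3 * a\<^sup>2 - 3*b*c*of_int d = of_int s"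
    and n: "a^3 + of_int d * b^3 + (of_int d)\<^sup>2 * c^3 - 3*a*b*c*of_int d = of_int n"
  shows "\<not> 3 dvd Gcd (range (poly (cubic t s n)))"
proof
  assume 3: "3 dvd Gcd (range (poly (cubic t s n)))"
  have dvd: "3 dvd poly (cubic t s n) x" for x
    using 3 Gcd_dvd[of "poly (cubic t s n) x" "range (poly (cubic t s n))"] by (metis dvd_trans rangeI)
  \<comment> \<open>The value at 0 gives \<open>3 dvd n\<close>; the values at 1 and 2 then
    determine \<open>t\<close> and \<open>s\<close> modulo 3.\<close>
  have "3 dvd t \<and> 3 dvd s + 1" using dvd[of 0] dvd[of 1] dvd[of 2] by simp presburger
  then obtain a0 where a0: "t = 3 * a0" and s3: "3 dvd s + 1" by auto
  have a: "a = of_int a0" using t a0 by simp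
  \<comment> \<open>\<open>x^3 + s' x - n'\<close> is the characteristic polynomial of the
    trace-free \<open>\<theta> - a0\<close>; \<open>u\<close> and \<open>v\<close> are the norms of
    \<open>b \<alpha>\<close> and \<open>c \<alpha>^2\<close>.\<close>
  define s' n' where "s' = s - 3 * a0\<^sup>2" and "n' = n - a0^3 - a0 * s'"
  define u v where "u = of_int d * b^3" and "v = (of_int d)\<^sup>2 * c^3"
  have s': "of_int s' = - 3*b*c*of_int d" using s by (simp add: s'_def a algebra_simps)
  have n': "u + v = of_int n'" using n by (simp add: n'_def s' a u_def v_def algebra_simps)
  have "27 * (u * v) = - (of_int s' ^ 3)"
    unfolding s' u_def v_def by (simp add: algebra_simps power2_eq_square power3_eq_cube)
  moreover have "(9 * (u - v))\<^sup>2 = 81 * (u + v)\<^sup>2 - 12 * (27 * (u * v))"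
    by (simp add: algebra_simps power2_eq_square)
  ultimately have sq: "(9 * (u - v))\<^sup>2 = of_int (81 * n'\<^sup>2 + 12 * s'^3)"
    by (simp add: n')
  \<comment> \<open>that is, \<open>- 3\<close> times the discriminant of the cubic is a square\<close>
  then have "9 * (u - v) \<in> \<int>" by (rule rat_root_of_int) simp
  then obtain r where "9 * (u - v) = of_int r" by (elim Ints_cases)
  with sq have "of_int (r\<^sup>2) = (of_int (81 * n'\<^sup>2 + 12 * s'^3) :: rat)" by simp
  then have r: "r\<^sup>2 = 3 * (27 * n'\<^sup>2 + 4 * s'^3)" unfolding of_int_eq_iff by simp
  moreover have p3: "prime (3 :: int)" by simp
  ultimately have "3 dvd r\<^sup>2" by simp
  then have "3 dvd r" by (rule prime_dvd_power[OF p3])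
  then obtain q where "r = 3 * q" by auto
  \<comment> \<open>As \<open>9\<close> divides \<open>r\<^sup>2\<close>, a further 3 must divide
    \<open>4 * s'^3\<close>, although \<open>s'\<close> is congruent to \<open>s\<close>, hence to
    -1, modulo 3.\<close>
  with r have "4 * s'^3 = 3 * (q\<^sup>2 - 9 * n'\<^sup>2)" by (simp add: power_mult_distrib)
  then have "3 dvd 4 * s'^3" by simp
  then have "3 dvd s'^3" by presburger
  then have "3 dvd s'" by (rule prime_dvd_power[OF p3])
  then show False using s3 by (simp add: s'_def) presburger
qed

section \<open>Parity of the coefficients for even \<open>d\<close>\<close>

text \<open>Multiplying by a rational cube changes the 2-adic valuation by a multiple of 3, so that
  of \<open>u\<close> cannot be 0.\<close>

lemma even_if_rat_cube_multiple:
  fixes x :: rat and e u :: int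
  assumes x: "of_int e * x ^ 3 = of_int u" and e: "e \<noteq> 0" "\<not> 3 dvd multiplicity 2 e"
  shows "even u"
proof (rule ccontr)
  assume u: "odd u"
  obtain p q :: int where pq: "x = of_int p / of_int q" "q > 0"
    using quotient_of_div[of x] quotient_of_denom_pos[of x] by (cases "quotient_of x") auto
  have "of_int (e * p ^ 3) = (of_int (u * q ^ 3) :: rat)"
    using x pq by (simp add: power_divide field_simps)
  then have eq: "e * p ^ 3 = u * q ^ 3" by (simp only: of_int_eq_iff)
  have "p \<noteq> 0" "u \<noteq> 0" using eq u pq by auto
  then have "multiplicity 2 e + 3 * multiplicity 2 p = multiplicity 2 u + 3 * multiplicity 2 q"
    using arg_cong[OF eq, of "multiplicity 2"] e pq
    by (simp add: prime_elem_multiplicity_mult_distrib prime_elem_multiplicity_power_distrib)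
  moreover have "multiplicity 2 u = 0" using u by (simp add: not_dvd_imp_multiplicity_0)
  ultimately show False using e(2) by presburger
qed

lemma two_not_dvd_cubic_values:
  fixes a b c :: rat and d t s n :: int
  assumes d: "cube_free d" "even d" "d \<noteq> 0"
    and t: "3 * a = of_int t" and s: "3 * a\<^sup>2 - 3*b*c*of_int d = of_int s"
    and n: "a^3 + of_int d * b^3 + (of_int d)\<^sup>2 * c^3 - 3*a*b*c*of_int d = of_int n"
  shows "\<not> 2 dvd Gcd (range (poly (cubic t s n)))"
proof
  assume 2: "2 dvd Gcd (range (poly (cubic t s n)))"
  have dvd: "2 dvd poly (cubic t s n) x" for x
    using 2 Gcd_dvd[of "poly (cubic t s n) x" "range (poly (cubic t s n))"] by (metis dvd_trans rangeI)
  have tsn: "even n" "even (1 - t + s - n)" using dvd[of 0] dvd[of 1] by simp_all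
  \<comment> \<open>The trace-free element is now \<open>3 \<theta> - t\<close>, with characteristic
    polynomial \<open>x^3 - 3 q x - m\<close> for the \<open>m\<close> below; \<open>u\<close> and
    \<open>v\<close> are the norms of its two components.\<close>
  define u v q where "u = of_int d * (3*b)^3" and "v = (of_int d)\<^sup>2 * (3*c)^3" and "q = t\<^sup>2 - 3 * s"
  have a: "a = of_int t / 3" using t by simp
  have q: "of_int q = 9*b*c*of_int d"
    using s by (simp add: q_def a power2_eq_square field_simps)
  define m where "m = 27 * n - t^3 + 3 * t * q"
  have uv: "u + v = of_int m"
    using n by (simp add: m_def q u_def v_def a power3_eq_cube field_simps)
  have prod: "u * v = of_int (q ^ 3)"
    by (simp add: q u_def v_def algebra_simps power2_eq_square power3_eq_cube)
  \<comment> \<open>By Vieta, \<open>u\<close> and \<open>v\<close> are the roots of a monic integer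
    quadratic.\<close>
  have int: "x \<in> \<int>" if "x = u \<or> x = v" for x
  proof (rule rat_quadratic_root_of_int)
    show "x\<^sup>2 - of_int m * x + of_int (q ^ 3) = 0"
      using that unfolding uv[symmetric] prod[symmetric] by (auto simp: algebra_simps power2_eq_square)
  qed
  obtain u' v' where u': "u = of_int u'" and v': "v = of_int v'" 
    using int[of u] int[of v] by (auto elim!: Ints_cases)
  have "multiplicity 2 d < 3"
    using d by (metis (full_types) cube_free_def multiplicity_dvd' not_less prime_int_numeral_eq two_is_prime_nat)
  moreover have "multiplicity 2 d > 0"
    using d by (simp add: prime_multiplicity_gt_zero_iff)
  \<comment> \<open>The exponent of 2 is 1 or 2 in \<open>d\<close>, hence 2 or 4 in
    \<open>d\<^sup>2\<close>.\<close>
  ultimately have nd: "\<not> 3 dvd multiplicity 2 d" "\<not> 3 dvd multiplicity 2 (d\<^sup>2)"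
    using d by (auto simp: prime_elem_multiplicity_power_distrib) presburger+
  have "even u'" by (rule even_if_rat_cube_multiple[of d "3*b"]) (use nd d u' in \<open>auto simp: u_def\<close>)
  moreover have "even v'" by (rule even_if_rat_cube_multiple[of "d\<^sup>2" "3*c"]) (use nd d v' in \<open>auto simp: v_def\<close>)
  moreover have "u' + v' = m" "u' * v' = q ^ 3"
    using uv prod unfolding u' v' by (metis of_int_add of_int_eq_iff, metis of_int_mult of_int_eq_iff)
  ultimately have "even m" "even (q ^ 3)" by (metis dvd_add, metis dvd_mult)
  then have "even q" "even (t ^ 3 + n)" by (auto simp: m_def)
  \<comment> \<open>Modulo 2, \<open>q\<close> is \<open>t + s\<close>. With \<open>n\<close> even,
    \<open>t\<close> and \<open>s\<close> are even too, so the value \<open>1 - t + s - n\<close> at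
    1 is odd.\<close>
  then have "even (t + s)" "even (t + n)" by (auto simp: q_def)
  then show False using tsn by presburger
qed

section \<open>The index\<close>

context pure_cubic
begin

text \<open>Cayley-Hamilton, checked in coordinates by a Horner evaluation.\<close>

lemma field_char_poly_root:
  "poly (map_poly of_rat (field_char_poly (rat_adjoin \<alpha>) (elem a b c))) (elem a b c) = 0"
proof -
  let ?s = "3 * a\<^sup>2 - 3*b*c*of_int d" and ?e = "elem a b c"
  have "elem (- elem_norm a b c) 0 0 + ?e * (elem ?s 0 0 + ?e * (elem (- 3 * a) 0 0 + ?e)) = 0"
    unfolding elem_mult elem_add elem_eq_0_iff elem_norm_def
    by (simp add: algebra_simps power2_eq_square power3_eq_cube)
  then show ?thesis
    unfolding field_char_poly_elem elem_rat by (simp add: of_rat_hom.map_poly_pCons_hom del: of_rat_minus)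
qed

text \<open>The characteristic polynomial is here the minimal polynomial, so it divides any monic
  integer polynomial \<open>h\<close> that kills the element; Gauss's lemma then applies.\<close>

lemma field_char_poly_int:
  assumes alg: "algebraic_int (elem a b c)" and irr: "b \<noteq> 0 \<or> c \<noteq> 0"
  shows "\<exists>p. field_char_poly (rat_adjoin \<alpha>) (elem a b c) = rat_poly p"
proof -
  define F where "F = field_char_poly (rat_adjoin \<alpha>) (elem a b c)"
  define ev where "ev P = poly (map_poly of_rat P) (elem a b c)" for P
  have F: "lead_coeff F = 1" "degree F = 3" by (simp_all add: F_def field_char_poly_elem)
  obtain h :: "int poly" where h: "poly (map_poly of_int h) (elem a b c) = 0" "lead_coeff h = 1"
    using alg unfolding algebraic_int_altdef_ipoly by blast
  have "map_poly of_rat (rat_poly h) = (map_poly of_int h :: 'a poly)"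
    by (subst map_poly_map_poly) (simp_all add: o_def)
  then have h0: "ev (rat_poly h) = 0" using h by (simp add: ev_def)
  define R where "R = rat_poly h mod F"
  have "rat_poly h = F * (rat_poly h div F) + R" by (simp add: R_def)
  moreover interpret of_rat_poly: map_poly_comm_ring_hom "of_rat :: rat \<Rightarrow> 'a" ..
  have "ev (P * Q + S) = ev P * ev Q + ev S" for P Q S
    by (simp add: ev_def of_rat_poly.hom_mult of_rat_hom.map_poly_hom_add)
  ultimately have "ev (rat_poly h) = ev F * ev (rat_poly h div F) + ev R"
    by metis
  then have R0: "ev R = 0" using h0 field_char_poly_root by (simp add: ev_def F_def)
  have "F \<noteq> 0" using F by auto
  then have "degree R < 3" using degree_mod_less[of F "rat_poly h"] F by (auto simp: R_def)
  then have R: "R = [:coeff R 0, coeff R 1, coeff R 2:]"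
    by (intro poly_eqI) (auto simp: coeff_pCons coeff_eq_0 numeral_2_eq_2 split: nat.split)
  have "ev [:p, q, r:] = of_rat p + of_rat q * elem a b c + of_rat r * (elem a b c)\<^sup>2" for p q r
    by (simp add: ev_def of_rat_hom.map_poly_pCons_hom algebra_simps power2_eq_square)
  \<comment> \<open>The remainder has degree below 3 and vanishes at an element of degree 3.\<close>
  then have "coeff R 0 = 0 \<and> coeff R 1 = 0 \<and> coeff R 2 = 0"
    using R0 R elem_quadratic_0[OF irr] by metis
  then have "R = 0" using R by (metis pCons_0_0)
  then have "F * (rat_poly h div F) = rat_poly h" by (simp add: R_def mod_eq_0_iff_dvd)
  then show ?thesis using gauss_monic_factor F(1) h(2) unfolding F_def by blast
qed

lemma int_char_poly_eq:
  assumes "field_char_poly K \<theta> = rat_poly p"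
  shows "int_char_poly K \<theta> = p"
  unfolding int_char_poly_def assms by (rule the_equality) auto

text \<open>Translates a primitive integer into the rational coordinates and integer coefficients
  that the congruence lemmas take as hypotheses.\<close>

lemma primitive_integer_cases:
  assumes "\<theta> \<in> primitive_integers (rat_adjoin \<alpha>)"
  obtains a b c t s n where "3 * a = of_int t" "3 * a\<^sup>2 - 3*b*c*of_int d = of_int s"
    "elem_norm a b c = of_int n"
    "int_char_poly (rat_adjoin \<alpha>) \<theta> = cubic t s n"
proof -
  obtain a b c where \<theta>: "\<theta> = elem a b c"
    using assms by (auto simp: primitive_integers_def ring_of_integers_def rat_adjoin_alpha)
  have "algebraic_int (elem a b c)" "b \<noteq> 0 \<or> c \<noteq> 0"
    using assms primitive_irrational unfolding \<theta> primitive_integers_def ring_of_integers_def by auto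
  then obtain p where p: "field_char_poly (rat_adjoin \<alpha>) (elem a b c) = rat_poly p"
    using field_char_poly_int by blast
  have co: "coeff (rat_poly p) i = of_int (coeff p i)" for i by simp
  have "elem_norm a b c = of_int (- coeff p 0)" "3 * a\<^sup>2 - 3*b*c*of_int d = of_int (coeff p 1)"
      "3 * a = of_int (- coeff p 2)"
    using co[of 0] co[of 1] co[of 2] unfolding p[symmetric] field_char_poly_elem
    by (simp_all add: numeral_2_eq_2)
  moreover from this have "rat_poly p = rat_poly (cubic (- coeff p 2) (coeff p 1) (- coeff p 0))"
    unfolding p[symmetric] field_char_poly_elem by (simp add: of_int_hom.map_poly_pCons_hom)
  then have "p = cubic (- coeff p 2) (coeff p 1) (- coeff p 0)" by (simp only: of_int_poly_hom.eq_iff)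
  ultimately show ?thesis using that int_char_poly_eq[OF p] \<theta> by metis
qed

text \<open>The index divides 6 and is prime to 3; for cube-free even \<open>d\<close> it is prime
  to 2 as well.\<close>

lemma
  assumes "\<theta> \<in> primitive_integers (rat_adjoin \<alpha>)"
  shows elem_index_dvd_2: "elem_index (rat_adjoin \<alpha>) \<theta> dvd 2"
    and elem_index_eq_1: "cube_free d \<Longrightarrow> even d \<Longrightarrow> elem_index (rat_adjoin \<alpha>) \<theta> = 1"
proof -
  obtain a b c t s n where *: "3 * a = of_int t" "3 * a\<^sup>2 - 3*b*c*of_int d = of_int s"
      "elem_norm a b c = of_int n" and p: "int_char_poly (rat_adjoin \<alpha>) \<theta> = cubic t s n"
    using primitive_integer_cases[OF assms] .
  define g where "g = Gcd (range (poly (cubic t s n)))"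
  have g: "g dvd 2 * 3" using cubic_values_dvd_6[of n s t] by (simp add: g_def)
  have "\<not> 3 dvd g"
    unfolding g_def using three_not_dvd_cubic_values[OF *(1,2) *(3)[unfolded elem_norm_def]] .
  moreover have "prime (3 :: int)" by simp
  ultimately have "coprime g 3" by (metis coprime_commute prime_imp_coprime)
  with g have g2: "g dvd 2" by (simp only: coprime_dvd_mult_left_iff)
  then show "elem_index (rat_adjoin \<alpha>) \<theta> dvd 2" by (simp add: elem_index_def p g_def)
  show "elem_index (rat_adjoin \<alpha>) \<theta> = 1" if "cube_free d" "even d"
  proof -
    have "\<not> 2 dvd g"
      unfolding g_def using two_not_dvd_cubic_values[OF that d_nonzero *(1,2) *(3)[unfolded elem_norm_def]] .
    then have "coprime g 2" by simp
    with g2 have "is_unit g" by (metis coprime_def dvd_refl)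
    then show ?thesis by (simp add: elem_index_def p g_def)
  qed
qed

section \<open>A primitive integer with even index for odd \<open>d\<close>\<close>

lemma alpha_plus_square_primitive: "\<alpha> + \<alpha>\<^sup>2 \<in> primitive_integers (rat_adjoin \<alpha>)"
  and elem_index_alpha_plus_square: "odd d \<Longrightarrow> even (elem_index (rat_adjoin \<alpha>) (\<alpha> + \<alpha>\<^sup>2))"
proof -
  let ?\<theta> = "\<alpha> + \<alpha>\<^sup>2" and ?p = "cubic 0 (- 3 * d) (d + d\<^sup>2)"
  have \<theta>: "?\<theta> = elem 0 1 1" by (simp add: elem_def)
  have F: "field_char_poly (rat_adjoin \<alpha>) ?\<theta> = rat_poly ?p"
    unfolding \<theta> field_char_poly_elem
    by (simp add: elem_norm_def of_int_hom.map_poly_pCons_hom)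
  have "map_poly of_rat (rat_poly ?p) = (map_poly of_int ?p :: 'a poly)"
    by (subst map_poly_map_poly) (simp_all add: o_def)
  then have "poly (map_poly of_int ?p) ?\<theta> = 0"
    using field_char_poly_root[of 0 1 1] F unfolding \<theta> by simp
  then have "algebraic_int ?\<theta>" unfolding algebraic_int_altdef_ipoly by (intro exI[of _ ?p]) simp
  moreover have mem: "?\<theta> \<in> rat_adjoin \<alpha>" unfolding \<theta> rat_adjoin_alpha by blast
  moreover have "rat_adjoin ?\<theta> = rat_adjoin \<alpha>"
  proof
    show "rat_adjoin ?\<theta> \<subseteq> rat_adjoin \<alpha>" by (intro rat_adjoin_minimal is_subfield_rat_adjoin mem)
    note F = is_subfield_rat_adjoin[of ?\<theta>] generator_in_rat_adjoin[of ?\<theta>]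
    have "d \<noteq> 1" using not_cube by (intro notI) simp
    then have "of_int d - 1 \<noteq> (0 :: rat)" by simp
    \<comment> \<open>Since \<open>\<alpha>^4 = d \<alpha>\<close>, one has
      \<open>\<theta>^2 - \<theta> - 2 d = (d - 1) \<alpha>\<close>; and \<open>d\<close> is not 1
      because 1 is a cube.\<close>
    then have "of_rat (1 / (of_int d - 1)) * (elem 0 1 1 * elem 0 1 1 + (- elem 0 1 1 + elem (- 2 * of_int d) 0 0))
        = elem 0 1 0"
      unfolding elem_mult elem_minus elem_add elem_scale elem_eq_iff by (simp add: field_simps)
    then have "of_rat (1 / (of_int d - 1)) * (?\<theta> * ?\<theta> + (- ?\<theta> + of_rat (- 2 * of_int d))) = \<alpha>"
      by (simp only: \<theta> elem_rat elem_alpha)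
    then have "\<alpha> \<in> rat_adjoin ?\<theta>"
      using F is_subfield_of_rat[OF F(1)] by (metis is_subfield_def)
    then show "rat_adjoin \<alpha> \<subseteq> rat_adjoin ?\<theta>" by (intro rat_adjoin_minimal is_subfield_rat_adjoin)
  qed
  ultimately show "?\<theta> \<in> primitive_integers (rat_adjoin \<alpha>)"
    by (simp add: primitive_integers_def ring_of_integers_def)
  show "even (elem_index (rat_adjoin \<alpha>) ?\<theta>)" if "odd d"
    unfolding elem_index_def int_char_poly_eq[OF F]
    \<comment> \<open>For odd \<open>d\<close> both \<open>x^3 - 3 d x\<close> and
      \<open>d + d^2\<close> are even.\<close>
    by (rule Gcd_greatest) (use that in auto)
qed

theorem field_index_pure_cubic:
  assumes "cube_free d"
  shows "field_index (rat_adjoin \<alpha>) = (if odd d then 2 else 1)"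
proof (cases "odd d")
  case True
  have "field_index (rat_adjoin \<alpha>) dvd 2"
    unfolding field_index_def by (rule Lcm_least) (auto dest: elem_index_dvd_2)
  moreover have "2 dvd field_index (rat_adjoin \<alpha>)"
    unfolding field_index_def
    using elem_index_alpha_plus_square[OF True] alpha_plus_square_primitive
    by (meson dvd_Lcm dvd_trans imageI)
  \<comment> \<open>Mutual divisibility fixes the integer up to sign, and an \<open>Lcm\<close> is
    nonnegative.\<close>
  ultimately have "\<bar>field_index (rat_adjoin \<alpha>)\<bar> = \<bar>2\<bar>" by (rule zdvd_antisym_abs)
  then show ?thesis using True by (simp add: field_index_def)
next
  case False
  then have "elem_index (rat_adjoin \<alpha>) ` primitive_integers (rat_adjoin \<alpha>) \<subseteq> {1}"
    using elem_index_eq_1 assms by auto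
  then have "field_index (rat_adjoin \<alpha>) = 1"
    unfolding field_index_def by (auto simp: Lcm_1_iff)
  then show ?thesis using False by simp
qed

end

theorem corollary1p1:
  fixes d :: int
  assumes "cube_free d" and "\<not> is_nth_power 3 d"
  shows "field_index (rat_adjoin (root 3 (real_of_int d))) = (if odd d then 2 else 1)"
proof -
  \<comment> \<open>As 3 is odd, \<open>root 3\<close> is a true cube root for negative
    \<open>d\<close> too.\<close>
  interpret pure_cubic "root 3 (real_of_int d)" d
    using assms(2) by unfold_locales (simp_all add: odd_real_root_pow)
  show ?thesis using assms(1) by (rule field_index_pure_cubic)
qed

end
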